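(* Let $\mu<1$ be arbitrary. There is a constant $C_\mu>0$ depending only on $\mu$ such that the following holds. For every continuous function $f:[0,1]\to[-\mu,\mu]$ and every positive integer $n$, there exist signs $\sigma_0,\dots,\sigma_n\in\{\pm1\}$ such that for all $x\in[0,1]$, with $X:=x(1-x)$, $$\left|f(x)-\sum_{k=0}^n\sigma_k\,p_{n,k}(x)\right|\le C_\mu\left(\omega_2\big(f,\sqrt{X/n}\big)+\frac{1}{1+nX}\right).$$ In particular, if $f$ has a Lipschitz derivative, then (with such signs) for all $x\in[0,1]$, $$\left|f(x)-\sum_{k=0}^n\sigma_k\,p_{n,k}(x)\right|\le C_\mu\,\frac{1+|f'|_{\mathrm{Lip}}}{1+nX}.$$
   Context: For $0\le k\le n$, $p_{n,k}(x):=\binom{n}{k}x^k(1-x)^{n-k}$ are the Bernstein basis polynomials of order $n$. $\omega_2(f,t):=\sup_{0\le h\le t}\ \sup_{x,\,x+2h\in[0,1]}|f(x)-2f(x+h)+f(x+2h)|$ is the second modulus of smoothness of $f$ on $[0,1]$ in the uniform norm. $|g|_{\mathrm{Lip}}$ is the Lipschitz seminorm (smallest Lipschitz constant) of $g$ on $[0,1]$. *)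

theory Defs
  imports "HOL-Analysis.Analysis"
begin

text \<open>
  The supremum is taken jointly over \<open>h\<close> and \<open>x\<close> rather than as an iterated supremum: for
  \<open>h > 1/2\<close> there is no admissible \<open>x\<close>, and the supremum of the empty set is unspecified on
  the reals. The joint set is nonempty for \<open>t \<ge> 0\<close> and bounded above for bounded \<open>f\<close>.
\<close>
definition second_modulus :: "(real \<Rightarrow> real) \<Rightarrow> real \<Rightarrow> real" where
  "second_modulus f t =
     Sup {\<bar>f x - 2 * f (x + h) + f (x + 2 * h)\<bar> | x h.
            0 \<le> h \<and> h \<le> t \<and> x \<in> {0..1} \<and> x + 2 * h \<in> {0..1}}"

text \<open>
  Meaningful only if \<open>g\<close> is Lipschitz on \<open>[0,1]\<close>; the infimum is then attained.
\<close>
definition lip_seminorm :: "(real \<Rightarrow> real) \<Rightarrow> real" where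
  "lip_seminorm g = Inf {L. L-lipschitz_on {0..1} g}"

end

theory Submission imports Defs begin

text \<open>
  Second-order noise shaping: a one-bit second-order sigma-delta quantizer with bounded state
  \<open>u\<close> writes \<open>f (k / n) - \<sigma> k\<close> as the second difference of \<open>u\<close>. Summation by parts moves that
  difference onto the Bernstein basis, where \<open>(n + 1) (n + 2) X\<^sup>2\<close> times the second difference
  is \<open>Bernstein (n + 2) (k + 2) x\<close> times a quadratic in \<open>k\<close> of mean absolute value at most
  \<open>2 (n + 2) X\<close>; this gives the error \<open>O(1 / (1 + n X))\<close>. The remaining error \<open>f - B\<^sub>n f\<close> is
  controlled by an affine function that approximates \<open>f\<close> on an interval of length \<open>2 t\<close> around
  \<open>x\<close>, \<open>t = sqrt (X / n)\<close>, up to \<open>\<omega>\<^sub>2(f, t)\<close>, and elsewhere up to \<open>\<omega>\<^sub>2(f, t)\<close> times a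
  quadratic in \<open>\<bar>y - x\<bar> / t\<close>: the Bernstein operator reproduces affine functions and its
  variance is \<open>X / n = t\<^sup>2\<close>.
\<close>

section \<open>One-bit second-order quantization\<close>

text \<open>
  The state \<open>(a, v)\<close> satisfies \<open>v' = v + y - \<sigma>\<close>, \<open>a' = a + v'\<close>. While \<open>a > 0\<close> the sign rule lowers
  \<open>v\<close> by at least \<open>\<delta>\<close> per step until \<open>v \<le> 0\<close>, so that \<open>a + g v\<close> does not increase, where \<open>g v\<close> bounds
  the total by which \<open>a\<close> still grows; while \<open>a \<le> 0\<close> one step cannot lift \<open>a + g v\<close> above \<open>M\<close>.
  Negative \<open>a\<close> is symmetric. The sequence \<open>u\<close> is \<open>a\<close> shifted by one.
\<close>
lemma second_order_one_bit_quantization: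
  fixes y :: "nat \<Rightarrow> real" and \<delta> :: real
  assumes \<delta>: "\<delta> > 0" and y: "\<And>k. \<bar>y k\<bar> \<le> 1 - \<delta>"
  obtains \<sigma> u :: "nat \<Rightarrow> real"
  where "\<And>k. \<sigma> k \<in> {-1, 1}" "\<And>k. \<bar>u k\<bar> \<le> 2 + 2 / \<delta>"
    "u 0 = 0" "u (Suc 0) = 0"
    "\<And>k. y k - \<sigma> k = u (Suc (Suc k)) - 2 * u (Suc k) + u k"
proof -
  \<comment> \<open>The thresholds keep \<open>\<bar>v\<bar> \<le> 2\<close>. For
    \<open>a > 0\<close> the bit is 1 unless \<open>v + z \<le> -1\<close>: with bit 1,
    \<open>v\<close> drops by at least \<open>\<delta>\<close> but stays above -2; with bit -1 it
    rises, but not above 0.\<close>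
  define bit :: "real \<Rightarrow> real \<Rightarrow> real \<Rightarrow> real" where
    "bit a v z = (if v + z > (if a > 0 then -1 else 1) then 1 else -1)" for a v z
  define st where "st = rec_nat (0::real, 0::real)
    (\<lambda>k (a, v). (a + (v + y k - bit a v (y k)), v + y k - bit a v (y k)))"
  define a v where "a k = fst (st k)" and "v k = snd (st k)" for k
  define \<sigma> where "\<sigma> k = bit (a k) (v k) (y k)" for k
  have rec: "v (Suc k) = v k + y k - \<sigma> k" "a (Suc k) = a k + v (Suc k)" for k
    by (simp_all add: a_def v_def \<sigma>_def st_def split: prod.split)
  have init: "a 0 = 0" "v 0 = 0"
    by (simp_all add: a_def v_def st_def)
  \<comment> \<open>The positive terms of (s - \<delta>) + (s - 2\<delta>) + ... sum to at most the
    area of a triangle of height s and slope \<delta>.\<close>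
  define g where "g s = (max s 0)\<^sup>2 / (2 * \<delta>)" for s :: real
  \<comment> \<open>A step from \<open>a \<le> 0\<close> ends at \<open>a \<le> 2\<close>, and
    \<open>g\<close> is at most 2^2 / (2\<delta>) on arguments up to 2.\<close>
  define M where "M = 2 + 2 / \<delta>"
  have g0: "g s \<ge> 0" for s using \<delta> by (simp add: g_def)
  have gneg: "g s = 0" if "s \<le> 0" for s using that by (simp add: g_def)
  have gmax: "g s \<le> 2 / \<delta>" if "s \<le> 2" for s
  proof -
    have "(max s 0)\<^sup>2 \<le> 2\<^sup>2" using that by (intro power_mono) auto
    then show ?thesis using \<delta> by (simp add: g_def field_simps)
  qed
  have descent: "s' + g s' \<le> g s" if "s' \<le> s - \<delta>" for s s'
  proof (cases "s' \<le> 0")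
    case True then show ?thesis using g0[of s] gneg[of s'] by linarith
  next
    case False
    then have "(s' + \<delta>)\<^sup>2 \<le> s\<^sup>2" using that \<delta> by (intro power_mono) auto
    then have "2 * \<delta> * s' + s'\<^sup>2 \<le> s\<^sup>2"
      by (simp add: power2_sum algebra_simps) (smt (verit) zero_le_power2)
    then have "(2 * \<delta> * s' + s'\<^sup>2) / (2 * \<delta>) \<le> s\<^sup>2 / (2 * \<delta>)"
      using \<delta> by (intro divide_right_mono) auto
    then show ?thesis using False that \<delta> by (simp add: g_def add_divide_distrib max_def)
  qed
  have inv: "\<bar>v k\<bar> \<le> 2 \<and> a k + g (v k) \<le> M \<and> - a k + g (- v k) \<le> M" for k
  proof (induction k)
    case 0 then show ?case using \<delta> by (simp add: init g_def M_def)
  next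
    case (Suc k)
    have yk: "y k \<le> 1 - \<delta>" "- y k \<le> 1 - \<delta>" using y[of k] by auto
    have v': "\<bar>v (Suc k)\<bar> \<le> 2"
      using Suc yk \<delta> unfolding rec(1) \<sigma>_def bit_def by (auto split: if_splits)
    have up: "a (Suc k) + g (v (Suc k)) \<le> M"
    proof (cases "a k > 0")
      case True
      then have "v (Suc k) \<le> v k - \<delta> \<or> v (Suc k) \<le> 0"
        using yk unfolding rec(1) \<sigma>_def bit_def by (auto split: if_splits)
      then have "v (Suc k) + g (v (Suc k)) \<le> g (v k)"
        using descent g0[of "v k"] gneg[of "v (Suc k)"] by fastforce
      then show ?thesis using Suc rec(2)[of k] by linarith
    next
      case False
      then show ?thesis
        using v' gmax[of "v (Suc k)"] rec(2)[of k] unfolding M_def abs_le_iff by linarith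
    qed
    have dn: "- a (Suc k) + g (- v (Suc k)) \<le> M"
    proof (cases "a k > 0")
      case False
      then have "- v (Suc k) \<le> - v k - \<delta> \<or> - v (Suc k) \<le> 0"
        using yk unfolding rec(1) \<sigma>_def bit_def by (auto split: if_splits)
      then have "- v (Suc k) + g (- v (Suc k)) \<le> g (- v k)"
        using descent[of "- v (Suc k)" "- v k"] g0[of "- v k"] gneg[of "- v (Suc k)"] by fastforce
      then show ?thesis using Suc rec(2)[of k] by linarith
    next
      case True
      then show ?thesis
        using v' gmax[of "- v (Suc k)"] rec(2)[of k] unfolding M_def abs_le_iff by linarith
    qed
    show ?case using v' up dn by blast
  qed
  \<comment> \<open>Since \<open>a 0 = v 0 = 0\<close>, the shift gives two initial zeros and the
    second-difference identity also holds at \<open>k = 0\<close>.\<close>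
  define u where "u k = (case k of 0 \<Rightarrow> 0 | Suc j \<Rightarrow> a j)" for k
  show ?thesis
  proof
    show "\<sigma> k \<in> {-1, 1}" for k by (simp add: \<sigma>_def bit_def)
    show "\<bar>u k\<bar> \<le> 2 + 2 / \<delta>" for k
    proof (cases k)
      case 0 then show ?thesis using \<delta> by (simp add: u_def)
    next
      case (Suc j)
      then have "u k = a j" by (simp add: u_def)
      then show ?thesis
        using inv[of j] g0[of "v j"] g0[of "- v j"] unfolding M_def abs_le_iff by linarith
    qed
    show "u 0 = 0" "u (Suc 0) = 0" by (simp_all add: u_def init)
    show "y k - \<sigma> k = u (Suc (Suc k)) - 2 * u (Suc k) + u k" for k
      by (cases k) (simp_all add: u_def rec init)
  qed
qed

section \<open>Summation by parts and second differences of the Bernstein basis\<close>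

text \<open>Explicit boundary terms make plain induction work. In the application they all vanish:
  \<open>u\<close> starts with two zeros, and Bernstein polynomials of index above \<open>n\<close>
  are 0.\<close>

lemma sum_second_difference_by_parts:
  fixes u p :: "nat \<Rightarrow> real"
  shows "(\<Sum>k\<le>n. (u (Suc (Suc k)) - 2 * u (Suc k) + u k) * p k) =
    (\<Sum>k\<le>n. u (Suc (Suc k)) * (p k - 2 * p (Suc k) + p (Suc (Suc k))))
    + u 0 * p 0 + u (Suc 0) * (p 1 - 2 * p 0) + 2 * u (Suc (Suc n)) * p (Suc n)
    - u (Suc n) * p (Suc n) - u (Suc (Suc n)) * p (Suc (Suc n))"
  by (induction n) (simp_all add: algebra_simps)

text \<open>With its companion for \<open>1 - x\<close>, this turns Bernstein polynomials of
  neighbouring indices into multiples of a single one of higher degree.\<close>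

lemma Bernstein_degree_raise_x:
  "(real n + 1) * x * Bernstein n k x = (real k + 1) * Bernstein (Suc n) (Suc k) x"
proof -
  have "(real k + 1) * real (Suc n choose Suc k) = (real n + 1) * real (n choose k)"
    using arg_cong[OF Suc_times_binomial[of k n], of real] by (simp add: algebra_simps)
  then have "(real k + 1) * real (Suc n choose Suc k) * (x * x ^ k * (1 - x) ^ (n - k)) =
      (real n + 1) * real (n choose k) * (x * x ^ k * (1 - x) ^ (n - k))"
    by (simp only:)
  then show ?thesis by (simp only: Bernstein_def diff_Suc_Suc power_Suc mult_ac)
qed

lemma Bernstein_degree_raise_1_minus_x:
  "(real n + 1) * (1 - x) * Bernstein n k x = (real n + 1 - real k) * Bernstein (Suc n) k x"
proof (cases "k \<le> n")
  case True
  have "real (Suc n - k) * real (Suc n choose k) = (real n + 1) * real (n choose k)"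
    using arg_cong[OF binomial_absorb_comp[of "Suc n" k], of real]
    by (simp add: mult.commute distrib_right del: binomial_Suc_Suc)
  then have "(real n + 1 - real k) * real (Suc n choose k) * (x ^ k * (1 - x) ^ Suc (n - k)) =
      (real n + 1) * real (n choose k) * (x ^ k * (1 - x) ^ Suc (n - k))"
    using True by (simp add: of_nat_diff add_ac)
  then show ?thesis
    using True by (simp only: Bernstein_def Suc_diff_le power_Suc mult_ac)
next
  case False
  \<comment> \<open>At \<open>k = n + 1\<close> the factor \<open>n + 1 - k\<close> vanishes; beyond
    that both binomial coefficients do.\<close>
  then show ?thesis
    by (cases "k = Suc n") (simp_all add: Bernstein_def binomial_eq_0 del: binomial_Suc_Suc)
qed

text \<open>With K = k + 2 and N = n + 2, two degree raises per term give the factor K(K-1)(1-x)^2 -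
  2K(N-K)x(1-x) + (N-K)(N-K-1)x^2. The square of K(1-x) - (N-K)x = K - Nx splits off.\<close>

lemma Bernstein_second_difference:
  "(real n + 2) * (real n + 1) * (x * (1 - x))\<^sup>2 *
      (Bernstein n k x - 2 * Bernstein n (Suc k) x + Bernstein n (Suc (Suc k)) x) =
    Bernstein (n + 2) (k + 2) x *
      ((real (k + 2) - real (n + 2) * x)\<^sup>2
        - (real (k + 2) * (1 - x)\<^sup>2 + (real (n + 2) - real (k + 2)) * x\<^sup>2))"
proof -
  define P where "P = Bernstein (n + 2) (k + 2) x"
  note raise = Bernstein_degree_raise_x Bernstein_degree_raise_1_minus_x
  have A: "(real n + 2) * (real n + 1) * x\<^sup>2 * Bernstein n k x
      = (real k + 2) * (real k + 1) * P"
  proof -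
    have "(real n + 2) * (real n + 1) * x\<^sup>2 * Bernstein n k x
        = (real n + 2) * x * ((real n + 1) * x * Bernstein n k x)"
      by (simp add: power2_eq_square mult_ac)
    also have "\<dots> = (real k + 1) * ((real (Suc n) + 1) * x * Bernstein (Suc n) (Suc k) x)"
      by (subst raise(1)) (simp add: mult_ac add_ac)
    also have "\<dots> = (real k + 1) * ((real (Suc k) + 1) * P)"
      by (subst raise(1)) (simp add: P_def)
    finally show ?thesis by (simp add: mult_ac add_ac)
  qed
  have B: "(real n + 2) * (real n + 1) * (x * (1 - x)) * Bernstein n (Suc k) x
      = (real k + 2) * (real n - real k) * P"
  proof -
    have "(real n + 2) * (real n + 1) * (x * (1 - x)) * Bernstein n (Suc k) x
        = (real n + 2) * x * ((real n + 1) * (1 - x) * Bernstein n (Suc k) x)"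
      by (simp add: mult_ac)
    also have "\<dots> = (real n - real k) * ((real (Suc n) + 1) * x * Bernstein (Suc n) (Suc k) x)"
      by (subst raise(2)) (simp add: mult_ac add_ac)
    also have "\<dots> = (real n - real k) * ((real (Suc k) + 1) * P)"
      by (subst raise(1)) (simp add: P_def)
    finally show ?thesis by (simp add: mult_ac add_ac)
  qed
  have C: "(real n + 2) * (real n + 1) * (1 - x)\<^sup>2 * Bernstein n (Suc (Suc k)) x
      = (real n - real k) * (real n - real k - 1) * P"
  proof -
    have "(real n + 2) * (real n + 1) * (1 - x)\<^sup>2 * Bernstein n (Suc (Suc k)) x
        = (real n + 2) * (1 - x) * ((real n + 1) * (1 - x) * Bernstein n (Suc (Suc k)) x)"
      by (simp add: power2_eq_square mult_ac)
    also have "\<dots> = (real n - real k - 1) *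
        ((real (Suc n) + 1) * (1 - x) * Bernstein (Suc n) (Suc (Suc k)) x)"
      by (subst raise(2)) (simp add: mult_ac add_ac)
    also have "\<dots> = (real n - real k - 1) * ((real n - real k) * P)"
      by (subst raise(2)) (simp add: P_def)
    finally show ?thesis by (simp add: mult_ac)
  qed
  have "(real n + 2) * (real n + 1) * (x * (1 - x))\<^sup>2 *
      (Bernstein n k x - 2 * Bernstein n (Suc k) x + Bernstein n (Suc (Suc k)) x) =
      (1 - x)\<^sup>2 * ((real n + 2) * (real n + 1) * x\<^sup>2 * Bernstein n k x)
      - 2 * (x * (1 - x)) * ((real n + 2) * (real n + 1) * (x * (1 - x)) * Bernstein n (Suc k) x)
      + x\<^sup>2 * ((real n + 2) * (real n + 1) * (1 - x)\<^sup>2 * Bernstein n (Suc (Suc k)) x)"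
    by algebra
  also have "\<dots> = P * ((real k + 2 - (real n + 2) * x)\<^sup>2
        - ((real k + 2) * (1 - x)\<^sup>2 + (real n + 2 - (real k + 2)) * x\<^sup>2))"
    unfolding A B C by algebra
  finally show ?thesis by (simp add: P_def add_ac)
qed

text \<open>Binomial variance from factorial moments: (k - nx)^2 = k(k-1) + (1 - 2nx)k +
  (nx)^2.\<close>

lemma sum_Bernstein_variance:
  "(\<Sum>k\<le>n. (real k - real n * x)\<^sup>2 * Bernstein n k x) = real n * (x * (1 - x))"
proof -
  have "(\<Sum>k\<le>n. (real k - real n * x)\<^sup>2 * Bernstein n k x) =
      (\<Sum>k\<le>n. real k * (real k - 1) * Bernstein n k x
        + (1 - 2 * real n * x) * (real k * Bernstein n k x)
        + (real n * x)\<^sup>2 * Bernstein n k x)"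
    by (intro sum.cong refl) algebra
  also have "\<dots> = real n * (real n - 1) * x\<^sup>2 + (1 - 2 * real n * x) * (real n * x) + (real n * x)\<^sup>2"
    by (simp only: sum.distrib sum_distrib_left[symmetric] sum_Bernstein sum_k_Bernstein
        sum_kk_Bernstein mult_1_right)
  also have "\<dots> = real n * (x * (1 - x))" by algebra
  finally show ?thesis .
qed

text \<open>Under binomial weights of degree N = n + 2, the square and the subtracted linear term
  each have mean N X. Their sum 2 N X, divided by N (n + 1) X^2, is the bound.\<close>

lemma sum_abs_Bernstein_second_difference:
  fixes x :: real
  assumes x: "0 < x" "x < 1"
  shows "(\<Sum>k\<le>n. \<bar>Bernstein n k x - 2 * Bernstein n (Suc k) x + Bernstein n (Suc (Suc k)) x\<bar>)
    \<le> 2 / ((real n + 1) * (x * (1 - x)))"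
proof -
  define N where "N = n + 2"
  define X where "X = x * (1 - x)"
  define D where
    "D k = Bernstein n k x - 2 * Bernstein n (Suc k) x + Bernstein n (Suc (Suc k)) x" for k
  define w where "w k = ((real k - real N * x)\<^sup>2 * Bernstein N k x
    + ((1 - x)\<^sup>2 * (real k * Bernstein N k x)
       + x\<^sup>2 * (real N * Bernstein N k x - real k * Bernstein N k x)))" for k
  define c where "c = (real n + 2) * (real n + 1) * X\<^sup>2"
  have X: "X > 0" using x by (simp add: X_def)
  have c: "c > 0" using X by (simp add: c_def add_pos_nonneg)
  have w_eq: "w k = Bernstein N k x * ((real k - real N * x)\<^sup>2
      + (real k * (1 - x)\<^sup>2 + (real N - real k) * x\<^sup>2))" for k
    unfolding w_def by (simp add: algebra_simps)
  have w0: "w k \<ge> 0" if "k \<le> N" for k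
    using that x unfolding w_eq by (intro mult_nonneg_nonneg add_nonneg_nonneg Bernstein_nonneg) auto
  have wD: "c * \<bar>D k\<bar> \<le> w (k + 2)" if "k \<le> n" for k
  proof -
    have tri: "\<bar>s - t\<bar> \<le> s + t" if "0 \<le> s" "0 \<le> t" for s t :: real using that by auto
    have "c * \<bar>D k\<bar> = \<bar>c * D k\<bar>" using c by (simp add: abs_mult)
    also have "\<dots> = \<bar>Bernstein N (k + 2) x * ((real (k + 2) - real N * x)\<^sup>2
        - (real (k + 2) * (1 - x)\<^sup>2 + (real N - real (k + 2)) * x\<^sup>2))\<bar>"
      unfolding c_def D_def X_def N_def Bernstein_second_difference ..
    also have "\<dots> \<le> w (k + 2)"
      unfolding w_eq abs_mult using that x
      by (intro mult_mono tri add_nonneg_nonneg mult_nonneg_nonneg)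
        (auto simp: N_def Bernstein_nonneg)
    finally show ?thesis .
  qed
  have "c * (\<Sum>k\<le>n. \<bar>D k\<bar>) \<le> (\<Sum>k\<le>n. w (k + 2))"
    unfolding sum_distrib_left using wD by (intro sum_mono) auto
  also have "\<dots> = sum w ((\<lambda>k. k + 2) ` {..n})"
    by (subst sum.reindex) (auto simp: inj_on_def)
  \<comment> \<open>The added terms \<open>k = 0, 1\<close> are nonnegative and complete the
    binomial moments.\<close>
  also have "\<dots> \<le> sum w {..N}"
    using w0 by (intro sum_mono2) (auto simp: N_def)
  also have "\<dots> = real N * X + ((1 - x)\<^sup>2 * (real N * x) + x\<^sup>2 * (real N - real N * x))"
    unfolding w_def sum.distrib sum_Bernstein_variance sum_distrib_left[symmetric] sum_subtractf
      sum_k_Bernstein sum_Bernstein X_def by simp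
  also have "\<dots> = 2 * (real n + 2) * X" unfolding X_def N_def of_nat_add of_nat_numeral by algebra
  finally have *: "c * (\<Sum>k\<le>n. \<bar>D k\<bar>) \<le> 2 * (real n + 2) * X" .
  have "c * (2 / ((real n + 1) * X)) = 2 * (real n + 2) * X"
  proof -
    have "c = (real n + 2) * X * ((real n + 1) * X)"
      by (simp add: c_def power2_eq_square mult_ac)
    moreover have "(real n + 1) * X \<noteq> 0" using X by auto
    ultimately show ?thesis by simp
  qed
  with * have "c * (\<Sum>k\<le>n. \<bar>D k\<bar>) \<le> c * (2 / ((real n + 1) * X))" by (rule ord_le_eq_trans[OF _ sym])
  then have "(\<Sum>k\<le>n. \<bar>D k\<bar>) \<le> 2 / ((real n + 1) * X)"
    using c by (rule mult_left_le_imp_le)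
  then show ?thesis by (simp add: D_def X_def)
qed

lemma noise_shaping_error:
  fixes u :: "nat \<Rightarrow> real"
  assumes u: "\<And>k. \<bar>u k\<bar> \<le> M" "u 0 = 0" "u (Suc 0) = 0" and x: "0 < x" "x < 1"
  shows "\<bar>\<Sum>k\<le>n. (u (Suc (Suc k)) - 2 * u (Suc k) + u k) * Bernstein n k x\<bar>
    \<le> 2 * M / ((real n + 1) * (x * (1 - x)))"
proof -
  let ?D = "\<lambda>k. Bernstein n k x - 2 * Bernstein n (Suc k) x + Bernstein n (Suc (Suc k)) x"
  have M: "M \<ge> 0" using u(1)[of 0] by linarith
  have z: "Bernstein n (Suc n) x = 0" "Bernstein n (Suc (Suc n)) x = 0"
    by (simp_all add: Bernstein_def)
  have "\<bar>\<Sum>k\<le>n. (u (Suc (Suc k)) - 2 * u (Suc k) + u k) * Bernstein n k x\<bar>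
      = \<bar>\<Sum>k\<le>n. u (Suc (Suc k)) * ?D k\<bar>"
    unfolding sum_second_difference_by_parts[where u = u and p = "\<lambda>k. Bernstein n k x"]
    by (simp add: u z)
  also have "\<dots> \<le> (\<Sum>k\<le>n. M * \<bar>?D k\<bar>)"
    by (rule order_trans[OF sum_abs]) (auto simp: abs_mult intro!: sum_mono mult_right_mono u)
  also have "\<dots> \<le> M * (2 / ((real n + 1) * (x * (1 - x))))"
    unfolding sum_distrib_left[symmetric]
    using sum_abs_Bernstein_second_difference[OF x] M by (intro mult_left_mono)
  finally show ?thesis by (simp add: mult.commute)
qed

section \<open>Second modulus of smoothness and affine approximation\<close>

lemma second_difference_le_second_modulus:
  assumes f: "f ` {0..1} \<subseteq> {-B..B}"
    and h: "0 \<le> h" "h \<le> t" "x \<in> {0..1}" "x + 2 * h \<in> {0..1}"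
  shows "\<bar>f x - 2 * f (x + h) + f (x + 2 * h)\<bar> \<le> second_modulus f t"
  unfolding second_modulus_def
proof (rule cSup_upper)
  show "bdd_above {\<bar>f x - 2 * f (x + h) + f (x + 2 * h)\<bar> | x h.
      0 \<le> h \<and> h \<le> t \<and> x \<in> {0..1} \<and> x + 2 * h \<in> {0..1}}"
  proof (rule bdd_aboveI, clarify)
    fix x h :: real
    assume *: "0 \<le> h" "x \<in> {0..1}" "x + 2 * h \<in> {0..1}"
    then have "f x \<in> {-B..B}" "f (x + h) \<in> {-B..B}" "f (x + 2 * h) \<in> {-B..B}"
      using f by (auto simp: image_subset_iff)
    then show "\<bar>f x - 2 * f (x + h) + f (x + 2 * h)\<bar> \<le> 4 * B" by auto
  qed
qed (use h in blast)

lemma second_modulus_nonneg: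
  assumes "f ` {0..1} \<subseteq> {-B..B}" "0 \<le> t"
  shows "0 \<le> second_modulus f t"
  using second_difference_le_second_modulus[of f B 0 t 0] assms by simp

text \<open>Summing once bounds the i-th first difference by w (2 + i), where 2w covers the initial
  difference; summing again bounds the values by w (1 + i)^2.\<close>

lemma quadratic_growth:
  fixes h :: "nat \<Rightarrow> real"
  assumes "\<bar>h 0\<bar> \<le> w" "\<bar>h 1\<bar> \<le> w"
    and "\<And>i. Suc (Suc i) \<le> n \<Longrightarrow> \<bar>h i - 2 * h (Suc i) + h (Suc (Suc i))\<bar> \<le> w"
  shows "\<bar>h n\<bar> \<le> w * (1 + real n)\<^sup>2"
proof -
  have w: "w \<ge> 0" using assms(1) by linarith
  have diff: "\<bar>h (Suc i) - h i\<bar> \<le> w * (2 + real i)" if "Suc i \<le> n" for i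
    using that
  proof (induction i)
    case 0 then show ?case using assms by auto
  next
    case (Suc i)
    then show ?case using assms(3)[of i] by (auto simp: algebra_simps)
  qed
  have "\<bar>h i\<bar> \<le> w * (1 + real i)\<^sup>2" if "i \<le> n" for i
    using that
  proof (induction i)
    case 0 then show ?case using assms by auto
  next
    case (Suc i)
    have "\<bar>h (Suc i)\<bar> \<le> w * (1 + real i)\<^sup>2 + w * (2 + real i)"
      using Suc diff[of i] by auto
    also have "\<dots> = w * ((1 + real i)\<^sup>2 + (2 + real i))" by (simp add: distrib_left)
    also have "\<dots> \<le> w * (1 + real (Suc i))\<^sup>2"
      using w by (intro mult_left_mono) (auto simp: power2_eq_square algebra_simps)
    finally show ?case .
  qed
  then show ?thesis by blast
qed

text \<open>Whitney's inequality of order two: at a maximum \<open>c\<close> of \<open>\<bar>g\<bar>\<close>, the symmetric second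
  difference centred at \<open>c\<close> and reaching to the nearer endpoint is at least \<open>\<bar>g c\<bar>\<close>.\<close>
lemma second_difference_bound_vanishing_endpoints:
  fixes g :: "real \<Rightarrow> real"
  assumes cont: "continuous_on {a..a + 2 * t} g" and "g a = 0" "g (a + 2 * t) = 0" and t: "t \<ge> 0"
    and w: "\<And>x h. \<lbrakk>0 \<le> h; h \<le> t; a \<le> x; x + 2 * h \<le> a + 2 * t\<rbrakk>
      \<Longrightarrow> \<bar>g x - 2 * g (x + h) + g (x + 2 * h)\<bar> \<le> w"
    and y: "y \<in> {a..a + 2 * t}"
  shows "\<bar>g y\<bar> \<le> w"
proof -
  have "\<exists>c\<in>{a..a + 2 * t}. \<forall>z\<in>{a..a + 2 * t}. \<bar>g z\<bar> \<le> \<bar>g c\<bar>"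
    using t by (intro continuous_attains_sup continuous_on_rabs cont) auto
  then obtain c where c: "c \<in> {a..a + 2 * t}"
    and max: "\<And>z. z \<in> {a..a + 2 * t} \<Longrightarrow> \<bar>g z\<bar> \<le> \<bar>g c\<bar>" by blast
  have "\<bar>g c\<bar> \<le> w"
  proof (cases "c \<le> a + t")
    case True
    have "\<bar>g a - 2 * g (a + (c - a)) + g (a + 2 * (c - a))\<bar> \<le> w"
      using c True by (intro w) auto
    moreover have "\<bar>g (a + 2 * (c - a))\<bar> \<le> \<bar>g c\<bar>"
      using c True by (intro max) auto
    ultimately show ?thesis using assms(2) by simp
  next
    case False
    define h where "h = a + 2 * t - c"
    have "\<bar>g (c - h) - 2 * g (c - h + h) + g (c - h + 2 * h)\<bar> \<le> w"
      using c False by (intro w) (auto simp: h_def)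
    moreover have "\<bar>g (c - h)\<bar> \<le> \<bar>g c\<bar>"
      using c False by (intro max) (auto simp: h_def)
    moreover have "g (c - h + 2 * h) = 0"
      using assms(3) by (simp add: h_def)
    ultimately show ?thesis by simp
  qed
  then show ?thesis using max[OF y] by linarith
qed

text \<open>The affine function is the chord of \<open>f\<close> over a window of length 2t
  containing \<open>x\<close>. Inside it the error is at most \<open>w\<close> by the bound for
  vanishing endpoints; elsewhere, steps of length \<open>t\<close> lead from \<open>y\<close> back
  into it, and the error grows quadratically in their number.\<close>

lemma affine_approximation:
  fixes f :: "real \<Rightarrow> real"
  assumes cont: "continuous_on {0..1} f" and t: "0 < t" "t \<le> 1 / 2" and x: "x \<in> {0..1}"
    and w: "\<And>x h. \<lbrakk>0 \<le> h; h \<le> t; x \<in> {0..1}; x + 2 * h \<in> {0..1}\<rbrakk>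
      \<Longrightarrow> \<bar>f x - 2 * f (x + h) + f (x + 2 * h)\<bar> \<le> w"
  obtains c d where
    "\<And>y. y \<in> {0..1} \<Longrightarrow> \<bar>f y - (c + d * y)\<bar> \<le> w * (18 + 2 * (y - x)\<^sup>2 / t\<^sup>2)"
proof -
  \<comment> \<open>Near 1 the window is pushed left to stay in [0,1]; \<open>t \<le> 1 / 2\<close>
    gives \<open>a \<ge> 0\<close>.\<close>
  define a where "a = min x (1 - 2 * t)"
  have a: "0 \<le> a" "a + 2 * t \<le> 1" "a \<le> x" "x \<le> a + 2 * t"
    using t x by (auto simp: a_def)
  define d where "d = (f (a + 2 * t) - f a) / (2 * t)"
  define c where "c = f a - d * a"
  define g where "g y = f y - (c + d * y)" for y
  have g_ends: "g a = 0" "g (a + 2 * t) = 0"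
    using t by (simp_all add: g_def c_def d_def field_simps)
  have g_cont: "continuous_on {a..a + 2 * t} g"
    unfolding g_def using a by (intro continuous_intros continuous_on_subset[OF cont]) auto
  have gw: "\<bar>g x - 2 * g (x + h) + g (x + 2 * h)\<bar> \<le> w"
    if "0 \<le> h" "h \<le> t" "x \<in> {0..1}" "x + 2 * h \<in> {0..1}" for x h
  proof -
    have "g x - 2 * g (x + h) + g (x + 2 * h) = f x - 2 * f (x + h) + f (x + 2 * h)"
      by (simp add: g_def algebra_simps)
    then show ?thesis using w[OF that] by simp
  qed
  have inner: "\<bar>g y\<bar> \<le> w" if "y \<in> {a..a + 2 * t}" for y
    using second_difference_bound_vanishing_endpoints[OF g_cont g_ends _ _ that] gw a t by auto
  have w0: "w \<ge> 0" using inner[of a] t by auto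
  \<comment> \<open>\<open>j\<close> counts steps from \<open>y\<close> into the window; the extra
    2t is the window length, as \<open>x\<close> may lie anywhere in it. The constants come from (3
    + s)^2 \<le> 18 + 2s^2.\<close>
  have final: "\<bar>g y\<bar> \<le> w * (18 + 2 * (y - x)\<^sup>2 / t\<^sup>2)"
    if j: "\<bar>g y\<bar> \<le> w * (1 + real j)\<^sup>2" "real j * t \<le> \<bar>y - x\<bar> + 2 * t" for y j
  proof -
    have "1 + real j \<le> 3 + \<bar>y - x\<bar> / t" using j(2) t by (simp add: field_simps)
    then have "(1 + real j)\<^sup>2 \<le> (3 + \<bar>y - x\<bar> / t)\<^sup>2" by (intro power_mono) auto
    also have "\<dots> \<le> 18 + 2 * (\<bar>y - x\<bar> / t)\<^sup>2"
      using zero_le_power2[of "3 - \<bar>y - x\<bar> / t"] unfolding power2_diff power2_sum by simp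
    also have "\<dots> = 18 + 2 * (y - x)\<^sup>2 / t\<^sup>2" by (simp add: power_divide)
    finally show ?thesis using j(1) w0 by (meson mult_left_mono order_trans)
  qed
  have "\<bar>g y\<bar> \<le> w * (18 + 2 * (y - x)\<^sup>2 / t\<^sup>2)" if y: "y \<in> {0..1}" for y
  proof (cases "y \<ge> a")
    case True
    \<comment> \<open>Now \<open>z\<close> lies in [a, a + t), so \<open>z\<close> and
      \<open>z + t\<close> are both in the window and start the recursion.\<close>
    define j where "j = nat \<lfloor>(y - a) / t\<rfloor>"
    define z where "z = y - real j * t"
    have "real j = of_int \<lfloor>(y - a) / t\<rfloor>" using True t by (simp add: j_def)
    then have "real j \<le> (y - a) / t" "(y - a) / t < real j + 1" by linarith+
    then have j: "real j * t \<le> y - a" "y - a < real j * t + t" using t by (simp_all add: field_simps)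
    have "\<bar>g (z + real j * t)\<bar> \<le> w * (1 + real j)\<^sup>2"
    proof (rule quadratic_growth[where h = "\<lambda>i. g (z + real i * t)"])
      show "\<bar>g (z + real 0 * t)\<bar> \<le> w" "\<bar>g (z + real 1 * t)\<bar> \<le> w"
        using j t by (auto simp: z_def intro!: inner)
      fix i assume "Suc (Suc i) \<le> j"
      then have "(real i + 2) * t \<le> real j * t" using t by (intro mult_right_mono) auto
      moreover have "0 \<le> real i * t" using t by simp
      moreover define s where "s = z + real i * t"
      ultimately have "0 \<le> s" "s + 2 * t \<le> 1"
        using j(1) a(1) t y unfolding z_def distrib_right atLeastAtMost_iff by linarith+
      then have "\<bar>g s - 2 * g (s + t) + g (s + 2 * t)\<bar> \<le> w"
        using t by (intro gw) auto
      then show "\<bar>g (z + real i * t) - 2 * g (z + real (Suc i) * t) + g (z + real (Suc (Suc i)) * t)\<bar> \<le> w"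
        by (simp add: s_def algebra_simps)
    qed
    then show ?thesis using j a by (intro final) (auto simp: z_def)
  next
    case False
    define b where "b = a + 2 * t"
    \<comment> \<open>Mirror image: \<open>z\<close> lies in (b - t, b] and the steps run to the
      left.\<close>
    define j where "j = nat \<lfloor>(b - y) / t\<rfloor>"
    define z where "z = y + real j * t"
    have "y \<le> b" using False t by (simp add: b_def)
    then have "real j = of_int \<lfloor>(b - y) / t\<rfloor>" using t by (simp add: j_def)
    then have "real j \<le> (b - y) / t" "(b - y) / t < real j + 1" by linarith+
    then have j: "real j * t \<le> b - y" "b - y < real j * t + t" using t by (simp_all add: field_simps)
    have "\<bar>g (z - real j * t)\<bar> \<le> w * (1 + real j)\<^sup>2"
    proof (rule quadratic_growth[where h = "\<lambda>i. g (z - real i * t)"])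
      show "\<bar>g (z - real 0 * t)\<bar> \<le> w" "\<bar>g (z - real 1 * t)\<bar> \<le> w"
        using j t by (auto simp: z_def b_def intro!: inner)
      fix i assume "Suc (Suc i) \<le> j"
      then have "(real i + 2) * t \<le> real j * t" using t by (intro mult_right_mono) auto
      moreover have "0 \<le> real i * t" using t by simp
      moreover define s where "s = z - (real i + 2) * t"
      ultimately have "0 \<le> s" "s + 2 * t \<le> 1"
        using j(1) a(2) t y unfolding z_def b_def distrib_right atLeastAtMost_iff by linarith+
      then have "\<bar>g s - 2 * g (s + t) + g (s + 2 * t)\<bar> \<le> w"
        using t by (intro gw) auto
      then show "\<bar>g (z - real i * t) - 2 * g (z - real (Suc i) * t) + g (z - real (Suc (Suc i)) * t)\<bar> \<le> w"
        by (simp add: s_def algebra_simps)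
    qed
    then show ?thesis using j a by (intro final) (auto simp: z_def b_def)
  qed
  then show thesis by (intro that[of c d]) (simp add: g_def)
qed

section \<open>Error of the Bernstein operator\<close>

lemma sum_Bernstein_variance_nodes:
  assumes "n > 0"
  shows "(\<Sum>k\<le>n. (real k / real n - x)\<^sup>2 * Bernstein n k x) = x * (1 - x) / real n"
proof -
  have "(\<Sum>k\<le>n. (real k / real n - x)\<^sup>2 * Bernstein n k x)
      = (\<Sum>k\<le>n. (real k - real n * x)\<^sup>2 * Bernstein n k x / (real n)\<^sup>2)"
  proof (intro sum.cong refl)
    fix k
    have "real k / real n - x = (real k - real n * x) / real n" using assms by (simp add: field_simps)
    then show "(real k / real n - x)\<^sup>2 * Bernstein n k x
        = (real k - real n * x)\<^sup>2 * Bernstein n k x / (real n)\<^sup>2"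
      by (simp add: power_divide)
  qed
  also have "\<dots> = x * (1 - x) / real n"
    using assms unfolding sum_divide_distrib[symmetric] sum_Bernstein_variance
    by (simp add: power2_eq_square)
  finally show ?thesis .
qed

lemma sum_affine_Bernstein:
  assumes "n > 0"
  shows "(\<Sum>k\<le>n. (c + d * (real k / real n)) * Bernstein n k x) = c + d * x"
proof -
  have "(\<Sum>k\<le>n. (c + d * (real k / real n)) * Bernstein n k x)
      = (\<Sum>k\<le>n. c * Bernstein n k x + d / real n * (real k * Bernstein n k x))"
    by (intro sum.cong) (simp_all add: algebra_simps)
  also have "\<dots> = c + d * x"
    using assms unfolding sum.distrib sum_distrib_left[symmetric] by simp
  finally show ?thesis .
qed

text \<open>\<open>A\<close> enters twice, for \<open>f\<close> at \<open>x\<close> and for the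
  average over the nodes. The quadratic part vanishes at \<open>x\<close> and averages to the
  variance.\<close>

lemma Bernstein_affine_error:
  assumes n: "n > 0" and x: "x \<in> {0..1}"
    and le: "\<And>y. y \<in> {0..1} \<Longrightarrow> \<bar>f y - (c + d * y)\<bar> \<le> A + B * (y - x)\<^sup>2"
  shows "\<bar>f x - (\<Sum>k\<le>n. f (real k / real n) * Bernstein n k x)\<bar>
    \<le> 2 * A + B * (x * (1 - x) / real n)"
proof -
  let ?y = "\<lambda>k. real k / real n"
  have "\<bar>(\<Sum>k\<le>n. f (?y k) * Bernstein n k x) - (c + d * x)\<bar>
      = \<bar>\<Sum>k\<le>n. (f (?y k) - (c + d * ?y k)) * Bernstein n k x\<bar>"
    by (subst sum_affine_Bernstein[OF n, symmetric]) (simp only: left_diff_distrib sum_subtractf)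
  also have "\<dots> \<le> (\<Sum>k\<le>n. (A + B * (?y k - x)\<^sup>2) * Bernstein n k x)"
  proof (intro order_trans[OF sum_abs] sum_mono)
    fix k assume "k \<in> {..n}"
    then have "?y k \<in> {0..1}" using n by simp
    from le[OF this]
    show "\<bar>(f (?y k) - (c + d * ?y k)) * Bernstein n k x\<bar>
        \<le> (A + B * (?y k - x)\<^sup>2) * Bernstein n k x"
      using x unfolding abs_mult by (simp add: Bernstein_nonneg mult_right_mono)
  qed
  also have "\<dots> = (\<Sum>k\<le>n. A * Bernstein n k x + B * ((?y k - x)\<^sup>2 * Bernstein n k x))"
    by (intro sum.cong) (simp_all add: algebra_simps)
  also have "\<dots> = A + B * (x * (1 - x) / real n)"
    by (simp add: sum.distrib sum_distrib_left[symmetric] sum_Bernstein_variance_nodes[OF n])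
  finally show ?thesis using le[OF x] by simp
qed

section \<open>Functions with Lipschitz derivative\<close>

text \<open>Each difference quotient is a lower bound of the nonempty set of Lipschitz constants,
  hence at most its infimum.\<close>

lemma lipschitz_on_lip_seminorm:
  assumes "\<exists>L. L-lipschitz_on {0..1} g"
  shows "(lip_seminorm g)-lipschitz_on {0..1} g"
proof (rule lipschitz_onI)
  show "0 \<le> lip_seminorm g"
    unfolding lip_seminorm_def using assms by (intro cInf_greatest) (auto dest: lipschitz_on_nonneg)
  fix x y :: real
  assume xy: "x \<in> {0..1}" "y \<in> {0..1}"
  show "dist (g x) (g y) \<le> lip_seminorm g * dist x y"
  proof (cases "x = y")
    case False
    have "dist (g x) (g y) / dist x y \<le> lip_seminorm g"
      unfolding lip_seminorm_def
    proof (rule cInf_greatest)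
      fix L assume "L \<in> {L. L-lipschitz_on {0..1} g}"
      then have "dist (g x) (g y) \<le> L * dist x y" using xy by (auto dest: lipschitz_onD)
      then show "dist (g x) (g y) / dist x y \<le> L" using False by (simp add: divide_le_eq)
    qed (use assms in auto)
    then show ?thesis using False by (simp add: divide_le_eq)
  qed simp
qed

text \<open>Mean value inequality for \<open>f z - f' x * z\<close> between \<open>x\<close> and
  \<open>y\<close>, where the derivative is at most \<open>L * \<bar>y - x\<bar>\<close> in absolute
  value.\<close>

lemma lipschitz_derivative_affine_error:
  fixes f f' :: "real \<Rightarrow> real"
  assumes deriv: "\<And>x. x \<in> {0..1} \<Longrightarrow> (f has_real_derivative f' x) (at x within {0..1})"
    and lip: "L-lipschitz_on {0..1} f'" and x: "x \<in> {0..1}" and y: "y \<in> {0..1}"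
  shows "\<bar>f y - (f x - f' x * x + f' x * y)\<bar> \<le> L * (y - x)\<^sup>2"
proof -
  let ?S = "{min x y..max x y}"
  have sub: "?S \<subseteq> {0..1}" using x y by auto
  have "norm ((f y - f' x * y) - (f x - f' x * x)) \<le> (L * \<bar>y - x\<bar>) * norm (y - x)"
  proof (rule field_differentiable_bound[of ?S "\<lambda>z. f z - f' x * z" "\<lambda>z. f' z - f' x"])
    fix z assume z: "z \<in> ?S"
    then show "((\<lambda>z. f z - f' x * z) has_field_derivative f' z - f' x) (at z within ?S)"
      using sub by (auto intro!: derivative_eq_intros DERIV_subset[OF deriv])
    have "\<bar>f' z - f' x\<bar> \<le> L * \<bar>z - x\<bar>"
      using lipschitz_onD[OF lip subsetD[OF sub z] x] by (simp add: dist_real_def)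
    also have "\<dots> \<le> L * \<bar>y - x\<bar>"
      using z lipschitz_on_nonneg[OF lip] by (intro mult_left_mono) auto
    finally show "norm (f' z - f' x) \<le> L * \<bar>y - x\<bar>" by simp
  qed auto
  then show ?thesis by (simp add: power2_eq_square algebra_simps)
qed

section \<open>Combination of the noise-shaping and Bernstein errors\<close>

theorem theorem3:
  fixes \<mu> :: real
  assumes "\<mu> < 1"
  shows "\<exists>C>0. \<forall>(f :: real \<Rightarrow> real) (n :: nat).
    continuous_on {0..1} f \<longrightarrow> f ` {0..1} \<subseteq> {-\<mu>..\<mu>} \<longrightarrow> n > 0 \<longrightarrow>
    (\<exists>\<sigma> :: nat \<Rightarrow> real.
      (\<forall>k\<le>n. \<sigma> k \<in> {-1, 1}) \<and>
      (\<forall>x\<in>{0..1}. let X = x * (1 - x) in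
        \<bar>f x - (\<Sum>k\<le>n. \<sigma> k * Bernstein n k x)\<bar>
          \<le> C * (second_modulus f (sqrt (X / real n)) + 1 / (1 + real n * X))) \<and>
      (\<forall>f' :: real \<Rightarrow> real.
        (\<forall>x\<in>{0..1}. (f has_real_derivative f' x) (at x within {0..1})) \<longrightarrow>
        (\<exists>L. L-lipschitz_on {0..1} f') \<longrightarrow>
        (\<forall>x\<in>{0..1}. let X = x * (1 - x) in
          \<bar>f x - (\<Sum>k\<le>n. \<sigma> k * Bernstein n k x)\<bar>
            \<le> C * ((1 + lip_seminorm f') / (1 + real n * X)))))"
proof -
  \<comment> \<open>\<open>M\<close> bounds the quantizer state for
    \<open>\<delta> = 1 - \<mu>\<close>. In \<open>C\<close>, 40 dominates the 38 from affine
    approximation, and \<open>4 * M\<close> is the noise-shaping constant.\<close>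
  define M where "M = 2 + 2 / (1 - \<mu>)"
  define C where "C = 40 + 4 * M"
  have M: "M \<ge> 2" using assms by (simp add: M_def)
  show ?thesis
  proof (rule exI[of _ C], intro conjI allI impI)
    show "C > 0" using M by (simp add: C_def)
    fix f :: "real \<Rightarrow> real" and n :: nat
    assume cont: "continuous_on {0..1} f" and f: "f ` {0..1} \<subseteq> {-\<mu>..\<mu>}" and n: "n > 0"
    have f_le: "\<bar>f x\<bar> \<le> \<mu>" if "x \<in> {0..1}" for x
    proof -
      have "f x \<in> {-\<mu>..\<mu>}" using f that by blast
      then show ?thesis by auto
    qed
    have \<mu>: "\<mu> \<ge> 0" using f_le[of 0] by simp
    \<comment> \<open>The quantizer takes an infinite sequence; zero padding respects its bound
      because \<open>\<mu> \<ge> 0\<close>.\<close>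
    define y where "y k = (if k \<le> n then f (real k / real n) else 0)" for k
    have "\<bar>y k\<bar> \<le> 1 - (1 - \<mu>)" for k
      using f_le \<mu> n by (simp add: y_def)
    \<comment> \<open>The signs depend on \<open>f\<close> and \<open>n\<close> alone and so serve
      every \<open>x\<close> and \<open>f'\<close>.\<close>
    then obtain \<sigma> u where \<sigma>: "\<And>k. \<sigma> k \<in> {-1, 1}" and u: "\<And>k. \<bar>u k\<bar> \<le> M" "u 0 = 0" "u (Suc 0) = 0"
      and yu: "\<And>k. y k - \<sigma> k = u (Suc (Suc k)) - 2 * u (Suc k) + u k"
      using second_order_one_bit_quantization[of "1 - \<mu>" y] assms unfolding M_def
      by (metis diff_gt_0_iff_gt)
    define S where "S x = (\<Sum>k\<le>n. \<sigma> k * Bernstein n k x)" for x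
    define B where "B x = (\<Sum>k\<le>n. f (real k / real n) * Bernstein n k x)" for x
    \<comment> \<open>\<open>E\<close> stands for either estimate of \<open>f - B\<close>. It is
      asked for only when X > 0: at the endpoints, where sqrt(X/n) degenerates to 0, the crude case
      nX \<le> 1 applies.\<close>
    have total: "\<bar>f x - S x\<bar> \<le> E + 4 * M / (1 + real n * (x * (1 - x)))"
      if x: "x \<in> {0..1}" and E: "E \<ge> 0" "0 < x * (1 - x) \<Longrightarrow> \<bar>f x - B x\<bar> \<le> E" for x E
    proof (cases "real n * (x * (1 - x)) \<le> 1")
      case True
      have "\<bar>S x\<bar> \<le> (\<Sum>k\<le>n. Bernstein n k x)"
        unfolding S_def
      proof (intro order_trans[OF sum_abs] sum_mono)
        fix k
        have "\<bar>\<sigma> k\<bar> = 1" using \<sigma>[of k] by auto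
        then show "\<bar>\<sigma> k * Bernstein n k x\<bar> \<le> Bernstein n k x"
          using x by (simp add: abs_mult Bernstein_nonneg)
      qed
      then have "\<bar>f x - S x\<bar> \<le> 2" using f_le[OF x] assms by simp
      also have "2 \<le> 4 * M / (1 + real n * (x * (1 - x)))"
      proof -
        have "0 \<le> real n * (x * (1 - x))" using x by simp
        then show ?thesis using M True by (simp add: le_divide_eq)
      qed
      finally show ?thesis using E(1) by simp
    next
      case False
      define X where "X = x * (1 - x)"
      have "x \<noteq> 0" "x \<noteq> 1" using False by auto
      then have x': "0 < x" "x < 1" using x by auto
      then have X: "X > 0" by (simp add: X_def)
      have nX: "real n * X > 1" using False by (simp add: X_def)
      have "B x - S x = (\<Sum>k\<le>n. (y k - \<sigma> k) * Bernstein n k x)"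
        by (simp add: B_def S_def y_def left_diff_distrib sum_subtractf)
      then have "\<bar>B x - S x\<bar> \<le> 2 * M / ((real n + 1) * X)"
        using noise_shaping_error[OF u x'] unfolding yu X_def by simp
      also have "\<dots> = 4 * M / (2 * ((real n + 1) * X))" by simp
      also have "\<dots> \<le> 4 * M / (1 + real n * X)"
      proof (rule frac_le)
        have "2 * ((real n + 1) * X) = 2 * (real n * X) + 2 * X" by (simp add: distrib_right)
        then show "1 + real n * X \<le> 2 * ((real n + 1) * X)" using nX X by linarith
      qed (use M nX in auto)
      finally show ?thesis using E(2) X by (simp add: X_def)
    qed
    show "\<exists>\<sigma>. (\<forall>k\<le>n. \<sigma> k \<in> {-1, 1}) \<and>
      (\<forall>x\<in>{0..1}. let X = x * (1 - x) in
        \<bar>f x - (\<Sum>k\<le>n. \<sigma> k * Bernstein n k x)\<bar>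
          \<le> C * (second_modulus f (sqrt (X / real n)) + 1 / (1 + real n * X))) \<and>
      (\<forall>f' :: real \<Rightarrow> real.
        (\<forall>x\<in>{0..1}. (f has_real_derivative f' x) (at x within {0..1})) \<longrightarrow>
        (\<exists>L. L-lipschitz_on {0..1} f') \<longrightarrow>
        (\<forall>x\<in>{0..1}. let X = x * (1 - x) in
          \<bar>f x - (\<Sum>k\<le>n. \<sigma> k * Bernstein n k x)\<bar>
            \<le> C * ((1 + lip_seminorm f') / (1 + real n * X))))"
      unfolding Let_def
    proof (rule exI[of _ \<sigma>], intro conjI allI ballI impI)
      fix x :: real assume x: "x \<in> {0..1}"
      define X where "X = x * (1 - x)"
      define t where "t = sqrt (X / real n)"
      define w where "w = second_modulus f t"
      have X0: "X \<ge> 0" using x by (simp add: X_def)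
      then have w: "w \<ge> 0" unfolding w_def by (intro second_modulus_nonneg[OF f]) (simp add: t_def)
      \<comment> \<open>38 = 2 * 18 + 2, as the variance X/n cancels t^2.\<close>
      have "\<bar>f x - B x\<bar> \<le> 38 * w" if "0 < X"
      proof -
        have t2: "t\<^sup>2 = X / real n" using X0 by (simp add: t_def)
        have t0: "t > 0" using that n by (simp add: t_def)
        have "X \<le> 1 / 4" using zero_le_power2[of "x - 1 / 2"]
          by (simp add: X_def power2_eq_square algebra_simps)
        then have "X / real n \<le> (1 / 4) / 1" using n X0 by (intro frac_le) auto
        then have "t\<^sup>2 \<le> (1 / 2)\<^sup>2" unfolding t2 power_divide by simp
        then have t1: "t \<le> 1 / 2" by (rule power2_le_imp_le) simp
        obtain c d where cd: "\<And>z. z \<in> {0..1} \<Longrightarrow> \<bar>f z - (c + d * z)\<bar> \<le> w * (18 + 2 * (z - x)\<^sup>2 / t\<^sup>2)"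
          using affine_approximation[OF cont t0 t1 x, of w]
            second_difference_le_second_modulus[OF f, of _ t] unfolding w_def by blast
        then have "\<bar>f z - (c + d * z)\<bar> \<le> 18 * w + 2 * w / t\<^sup>2 * (z - x)\<^sup>2" if "z \<in> {0..1}" for z
          using cd[OF that] by (simp add: distrib_left mult_ac)
        from Bernstein_affine_error[OF n x this]
        have "\<bar>f x - B x\<bar> \<le> 2 * (18 * w) + 2 * w / t\<^sup>2 * (X / real n)"
          by (simp add: B_def X_def)
        also have "\<dots> = 38 * w" using t0 unfolding t2[symmetric] by simp
        finally show ?thesis .
      qed
      then have "\<bar>f x - S x\<bar> \<le> 38 * w + 4 * M / (1 + real n * X)"
        using total[OF x, of "38 * w"] w by (simp add: X_def)
      also have "\<dots> \<le> C * w + C * (1 / (1 + real n * X))"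
      proof -
        have "4 * M / (1 + real n * X) \<le> C / (1 + real n * X)"
          using X0 by (intro divide_right_mono) (auto simp: C_def)
        moreover have "38 * w \<le> C * w" using w M by (intro mult_right_mono) (auto simp: C_def)
        ultimately show ?thesis by simp
      qed
      finally show "\<bar>f x - (\<Sum>k\<le>n. \<sigma> k * Bernstein n k x)\<bar>
          \<le> C * (second_modulus f (sqrt (x * (1 - x) / real n)) + 1 / (1 + real n * (x * (1 - x))))"
        by (simp only: S_def w_def t_def X_def distrib_left)
    next
      fix f' :: "real \<Rightarrow> real" and x :: real
      assume deriv: "\<forall>x\<in>{0..1}. (f has_real_derivative f' x) (at x within {0..1})"
        and "\<exists>L. L-lipschitz_on {0..1} f'" and x: "x \<in> {0..1}"
      define L where "L = lip_seminorm f'"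
      define X where "X = x * (1 - x)"
      have lip: "L-lipschitz_on {0..1} f'"
        unfolding L_def by (rule lipschitz_on_lip_seminorm) fact
      have L: "L \<ge> 0" using lip by (rule lipschitz_on_nonneg)
      have X0: "X \<ge> 0" "X \<le> 1" using x by (auto simp: X_def intro: mult_le_one)
      \<comment> \<open>The tangent at \<open>x\<close> is the affine function, so the constant part
        of its error is 0.\<close>
      have "\<bar>f x - B x\<bar> \<le> 2 * 0 + L * (X / real n)"
        unfolding B_def X_def
      proof (rule Bernstein_affine_error[OF n x])
        fix z :: real assume "z \<in> {0..1}"
        then show "\<bar>f z - (f x - f' x * x + f' x * z)\<bar> \<le> 0 + L * (z - x)\<^sup>2"
          using lipschitz_derivative_affine_error[OF _ lip x] deriv by simp
      qed
      \<comment> \<open>Multiplied out, this is X/n + X^2 \<le> 2.\<close>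
      moreover have "X / real n \<le> 2 / (1 + real n * X)"
      proof -
        have "X / real n \<le> 1 / 1" using X0 n by (intro frac_le) auto
        moreover have "X * X \<le> 1" using X0 by (intro mult_le_one) auto
        moreover have "X / real n * (1 + real n * X) = X / real n + X * X"
          using n by (simp add: distrib_left)
        ultimately have "X / real n * (1 + real n * X) \<le> 2" by linarith
        moreover have "1 + real n * X > 0" using X0 by (simp add: add_pos_nonneg)
        ultimately show ?thesis by (simp add: pos_le_divide_eq)
      qed
      then have "L * (X / real n) \<le> L * (2 / (1 + real n * X))" using L by (rule mult_left_mono)
      ultimately have "\<bar>f x - B x\<bar> \<le> L * (2 / (1 + real n * X))" by simp
      then have "\<bar>f x - S x\<bar> \<le> L * (2 / (1 + real n * X)) + 4 * M / (1 + real n * X)"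
        using total[OF x, of "L * (2 / (1 + real n * X))"] L X0 by (simp add: X_def)
      also have "\<dots> = (2 * L + 4 * M) / (1 + real n * X)" by (simp add: add_divide_distrib)
      also have "\<dots> \<le> (C * (1 + L)) / (1 + real n * X)"
      proof (rule divide_right_mono)
        have "2 * L \<le> C * L" using L M by (intro mult_right_mono) (auto simp: C_def)
        then show "2 * L + 4 * M \<le> C * (1 + L)" by (simp add: C_def distrib_left)
      qed (use X0 in simp)
      finally show "\<bar>f x - (\<Sum>k\<le>n. \<sigma> k * Bernstein n k x)\<bar>
            \<le> C * ((1 + lip_seminorm f') / (1 + real n * (x * (1 - x))))"
        by (simp add: S_def L_def X_def)
    qed (use \<sigma> in blast)
  qed
qed

end
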